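(* Let $h_M,h_E$ be independent nonnegative random variables with bounded continuous densities $f(h_M)$ and $f(h_E)$ on $[0,\infty)$, and let $\bar P>0$. Consider the problem of maximizing $$\int_0^\infty\int_{h_E}^\infty\Big[\log\big(1+h_MP(h_M,h_E)\big)-\log\big(1+h_EP(h_M,h_E)\big)\Big]f(h_M)f(h_E)\,dh_M\,dh_E$$ over all power allocation policies $P:[0,\infty)^2\to[0,\infty)$ with $\mathbb E\{P(h_M,h_E)\}\le\bar P$ (the maximum is the full-CSI secrecy capacity). The optimal power allocation policy is $$P(h_M,h_E)=\frac12\left[\sqrt{\Big(\frac1{h_E}-\frac1{h_M}\Big)^2+\frac4\lambda\Big(\frac1{h_E}-\frac1{h_M}\Big)}-\Big(\frac1{h_M}+\frac1{h_E}\Big)\right]^+\quad\text{for }h_M>h_E,$$ and $P(h_M,h_E)=0$ for $h_M\le h_E$, where $\lambda>0$ is a constant such that $\mathbb E\{P(h_M,h_E)\}=\bar P$.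
   Context: $h_M$ and $h_E$ are the fading power gains of the main channel and of the eavesdropper channel; the two densities may differ, the argument indicating which is meant. $[x]^+=\max\{0,x\}$. Here $\log$ is the natural logarithm (changing the base only rescales the objective).
   Formalization: A constant λ is shown to exist only when Pr(h_M > h_E) > 0 (otherwise the policy is a.s. 0 and no λ exists), and uniqueness of the optimal policy (almost surely) is claimed only when the maximum is finite (otherwise it fails); optimality holds for every such λ. *)

theory Defs
  imports "HOL-Probability.Probability"
begin

text \<open>
  Policies are functions of two real arguments, of which only the values on the
  quadrant of nonnegative channel gains matter; nothing is required elsewhere.

  Expectations of nonnegative quantities are Lebesgue integrals with values in the extended
  nonnegative reals, so that an average power bound excludes non-integrable policies (whereas the
  Bochner integral would assign them 0).
\<close>

definition avg_power ::
  "'a measure \<Rightarrow> ('a \<Rightarrow> real) \<Rightarrow> ('a \<Rightarrow> real) \<Rightarrow> (real \<Rightarrow> real \<Rightarrow> real) \<Rightarrow> ennreal" where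
  "avg_power M hM hE P = (\<integral>\<^sup>+ \<omega>. ennreal (P (hM \<omega>) (hE \<omega>)) \<partial>M)"

definition feasible_policy ::
  "'a measure \<Rightarrow> ('a \<Rightarrow> real) \<Rightarrow> ('a \<Rightarrow> real) \<Rightarrow> real \<Rightarrow> (real \<Rightarrow> real \<Rightarrow> real) \<Rightarrow> bool" where
  "feasible_policy M hM hE Pbar P \<longleftrightarrow>
     (\<lambda>(x, y). P x y) \<in> borel_measurable (restrict_space borel ({0..} \<times> {0..})) \<and>
     (\<forall>x\<ge>0. \<forall>y\<ge>0. 0 \<le> P x y) \<and>
     avg_power M hM hE P \<le> ennreal Pbar"

text \<open>
  On the domain of integration the integrand is nonnegative (for a nonnegative policy), so the
  truncation in \<^const>\<open>ennreal\<close> loses nothing. The value may be infinite, since the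
  logarithm of the main channel gain need not have finite expectation.
\<close>

definition secrecy_rate ::
  "(real \<Rightarrow> real) \<Rightarrow> (real \<Rightarrow> real) \<Rightarrow> (real \<Rightarrow> real \<Rightarrow> real) \<Rightarrow> ennreal" where
  "secrecy_rate fM fE P =
     (\<integral>\<^sup>+ y\<in>{0..}. (\<integral>\<^sup>+ x\<in>{y<..}.
        ennreal ((ln (1 + x * P x y) - ln (1 + y * P x y)) * fM x * fE y) \<partial>lborel) \<partial>lborel)"

text \<open>
  At \<open>y = 0\<close> the formula uses \<open>1 / 0 = 0\<close> and evaluates to 0; as the eavesdropper gain
  has a density, this is a null event.
\<close>

definition secrecy_policy :: "real \<Rightarrow> real \<Rightarrow> real \<Rightarrow> real" where
  "secrecy_policy lam x y =
     (if x > y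
      then 1 / 2 * max 0 (sqrt ((1 / y - 1 / x)\<^sup>2 + 4 / lam * (1 / y - 1 / x)) - (1 / x + 1 / y))
      else 0)"

end

theory Submission
  imports Defs
begin

text \<open>
  Lagrangian duality. For fixed gains \<open>x > y > 0\<close> the policy \<open>p\<close> is the KKT point of the
  maximization over \<open>q \<ge> 0\<close> of the rate \<open>ln (1 + x q) - ln (1 + y q)\<close> minus \<open>lam q\<close>: it is the
  positive root of \<open>x - y = lam (1 + x p) (1 + y p)\<close> if there is one and \<open>0\<close> otherwise. That it
  is the unique maximizer follows from \<open>ln r \<le> r - 1\<close> applied to the quotient \<open>r\<close> of the two
  rates' arguments. Integrating this pointwise inequality and cancelling the common power term
  \<open>lam Pbar\<close> gives optimality, and the equality case gives uniqueness. The multiplier comes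
  from the intermediate value theorem: the policy is bounded by \<open>1 / lam\<close>, so its average power is
  continuous in \<open>lam\<close> and at most \<open>Pbar\<close> at \<open>lam = 1 / Pbar\<close>, while by Fatou's lemma it is unbounded
  as \<open>lam\<close> tends to \<open>0\<close>.
\<close>

section \<open>The pointwise problem at fixed channel gains\<close>

text \<open>The zero branch turns the integral over gains with y < x into an expectation over the
  whole probability space, and makes power spent outside that region a pure loss in the
  Lagrangian.\<close>

definition wiretap_rate :: "real \<Rightarrow> real \<Rightarrow> real \<Rightarrow> real" where
  "wiretap_rate x y p = (if y < x then ln (1 + x * p) - ln (1 + y * p) else 0)"

lemma wiretap_rate_nonneg:
  assumes "0 \<le> y" "0 \<le> p"
  shows "0 \<le> wiretap_rate x y p"
proof (cases "y < x")
  case True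
  have "0 < 1 + y * p" "1 + y * p \<le> 1 + x * p"
    using assms True by (simp_all add: add_pos_nonneg mult_right_mono)
  then show ?thesis
    by (simp add: wiretap_rate_def)
qed (simp add: wiretap_rate_def)

lemma secrecy_policy_nonneg: "0 \<le> secrecy_policy lam x y"
  by (simp add: secrecy_policy_def)

text \<open>The KKT conditions: the marginal rate (x - y) / ((1 + x p) (1 + y p)) is at most
  \<open>lam\<close>, with equality when p > 0. With a = 1/x and b = 1/y, equality becomes (a + p)
  (b + p) = (b - a) / lam, a quadratic in p whose discriminant is the radicand of the policy.
  Truncation to 0 means that its larger root is not positive.\<close>

lemma secrecy_policy_stationary:
  fixes x y lam :: real
  assumes "0 < y" "y < x" "0 < lam"
  defines "p \<equiv> secrecy_policy lam x y"
  shows "x - y \<le> lam * ((1 + x * p) * (1 + y * p))"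
    and "0 < p \<Longrightarrow> x - y = lam * ((1 + x * p) * (1 + y * p))"
proof -
  define a where "a = 1 / x"
  define b where "b = 1 / y"
  define s where "s = sqrt ((b - a)\<^sup>2 + 4 / lam * (b - a))"
  have pos: "0 < a" "0 < b" "0 < x" using assms by (auto simp: a_def b_def)
  have xa: "x * a = 1" and yb: "y * b = 1" using assms by (auto simp: a_def b_def)
  have ba: "0 < b - a" using assms by (simp add: a_def b_def frac_less2)
  have xy: "x * y * (b - a) = x - y" using xa yb by algebra
  have s2: "s\<^sup>2 = (b - a)\<^sup>2 + 4 / lam * (b - a)"
    unfolding s_def using ba assms by (intro real_sqrt_pow2) simp
  have s0: "0 \<le> s" unfolding s_def using ba assms by simp
  have p: "p = 1 / 2 * max 0 (s - (a + b))"
    using assms by (simp add: secrecy_policy_def s_def a_def b_def)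
  have eq: "x - y = lam * ((1 + x * p) * (1 + y * p))" if "0 < p"
  proof -
    have "s = 2 * p + (a + b)" using that p by (simp add: max_def split: if_splits)
    with s2 have "4 * ((a + p) * (b + p)) = 4 / lam * (b - a)"
      by (simp add: power2_eq_square algebra_simps)
    then have "lam * ((a + p) * (b + p)) = b - a"
      using assms by (simp add: field_simps)
    then have "lam * ((x * a + x * p) * (y * b + y * p)) = x * y * (b - a)"
      by algebra
    then show ?thesis by (simp add: xa yb xy)
  qed
  then show "0 < p \<Longrightarrow> x - y = lam * ((1 + x * p) * (1 + y * p))" .
  show "x - y \<le> lam * ((1 + x * p) * (1 + y * p))"
  proof (cases "0 < p")
    case False
    then have p0: "p = 0" and "s \<le> a + b" using p by (auto simp: max_def split: if_splits)
    then have "s\<^sup>2 \<le> (a + b)\<^sup>2" using s0 by (intro power_mono) auto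
    then have "4 / lam * (b - a) \<le> 4 * (a * b)"
      unfolding s2 by (simp add: power2_eq_square algebra_simps)
    then have "b - a \<le> lam * (a * b)"
      using assms by (simp add: field_simps)
    then have "x * y * (b - a) \<le> x * y * (lam * (a * b))"
      using pos assms by (intro mult_left_mono) auto
    also have "\<dots> = lam" using xa yb by algebra
    finally show ?thesis by (simp add: p0 xy)
  qed (use eq in simp)
qed

text \<open>Completing the square bounds the radicand by (u + 2/lam)^2 with u = 1/y - 1/x. The bound
  does not depend on the gains, so it can dominate the policies under the integral.\<close>

lemma secrecy_policy_le:
  assumes "0 \<le> y" "0 < lam"
  shows "secrecy_policy lam x y \<le> 1 / lam"
proof (cases "y < x")
  case True
  show ?thesis
  proof (cases "y = 0")
    case y0: True
    \<comment> \<open>Here 1/y is 0, so the radicand is at most (1/x)^2. It may be negative, but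
      \<open>sqrt\<close> is monotone on all reals; hence the bracket is not positive and the policy
      vanishes.\<close>
    have "(- (1 / x))\<^sup>2 + 4 / lam * - (1 / x) \<le> (1 / x)\<^sup>2"
      using True y0 assms by simp
    then have "sqrt ((- (1 / x))\<^sup>2 + 4 / lam * - (1 / x)) \<le> 1 / x"
      using True y0 by (metis real_sqrt_abs real_sqrt_le_mono abs_of_pos zero_less_divide_1_iff)
    then have "secrecy_policy lam x y = 0"
      using True y0 by (simp add: secrecy_policy_def)
    then show ?thesis using assms by simp
  next
    case False
    define u where "u = 1 / y - 1 / x"
    have u: "0 < u" using True False assms by (simp add: u_def frac_less2)
    have "sqrt (u\<^sup>2 + 4 / lam * u) \<le> sqrt ((u + 2 / lam)\<^sup>2)"
      using assms by (intro real_sqrt_le_mono) (simp add: power2_eq_square field_simps)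
    also have "\<dots> = u + 2 / lam" using u assms by simp
    finally have "sqrt (u\<^sup>2 + 4 / lam * u) - (1 / x + 1 / y) \<le> 2 / lam - 2 / x"
      by (simp add: u_def)
    also have "\<dots> \<le> 2 / lam" using True assms by simp
    finally show ?thesis
      using True assms by (simp add: secrecy_policy_def u_def max_def)
  qed
next
  case False
  then show ?thesis using assms by (simp add: secrecy_policy_def)
qed

text \<open>Both claims follow from strict inequality for q different from p. The rate difference is
  ln r with r = (C B) / (D A); it lies strictly below r - 1, and the KKT conditions bound r - 1 by
  lam (q - p).\<close>

lemma secrecy_policy_lagrangian:
  fixes x y lam q :: real
  assumes "0 < y" "0 < lam" "0 \<le> q"
  defines "p \<equiv> secrecy_policy lam x y"
  shows "wiretap_rate x y q + lam * p \<le> wiretap_rate x y p + lam * q"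
    and "wiretap_rate x y p + lam * q \<le> wiretap_rate x y q + lam * p \<Longrightarrow> q = p"
proof -
  have p0: "0 \<le> p" by (simp add: p_def secrecy_policy_nonneg)
  have strict: "wiretap_rate x y q + lam * p < wiretap_rate x y p + lam * q" if "q \<noteq> p"
  proof (cases "y < x")
    case True
    define A B C D where "A = 1 + x * p" and "B = 1 + y * p" and "C = 1 + x * q" and "D = 1 + y * q"
    have pos: "0 < A" "0 < B" "0 < C" "0 < D"
      using p0 assms True by (auto simp: A_def B_def C_def D_def intro!: add_pos_nonneg)
    define r where "r = (C * B) / (D * A)"
    have r: "0 < r" using pos by (simp add: r_def)
    have "r - 1 = (C * B - D * A) / (D * A)"
      using pos by (simp add: r_def field_simps)
    also have "C * B - D * A = (x - y) * (q - p)"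
      unfolding A_def B_def C_def D_def by algebra
    finally have r1: "r - 1 = (x - y) * (q - p) / (D * A)" .
    then have "r \<noteq> 1" using that True pos by auto
    then have "ln r < r - 1"
      using r ln_le_minus_one[OF r] ln_eq_minus_one[OF r] by linarith
    moreover have "ln r = wiretap_rate x y q - wiretap_rate x y p"
      using True pos by (simp add: r_def wiretap_rate_def ln_div ln_mult flip: A_def B_def C_def D_def)
    moreover have "r - 1 \<le> lam * (q - p)"
    proof (cases "0 < p")
      case pp: True
      have "x - y = lam * (A * B)"
        using secrecy_policy_stationary(2)[of y x lam] True assms pp by (simp add: A_def B_def p_def)
      then have "r - 1 = lam * ((q - p) * B / D) * (A / A)"
        unfolding r1 by (simp only: times_divide_eq_left times_divide_eq_right divide_divide_eq_left ac_simps)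
      also have "\<dots> = lam * ((q - p) * B / D)"
        using pos by simp
      also have "\<dots> \<le> lam * (q - p)"
      proof -
        \<comment> \<open>Since D - B = y (q - p), the difference of the two sides is y (q - p)^2,
          so the sign of q - p does not matter.\<close>
        have "(q - p) * B \<le> (q - p) * D"
        proof -
          have "(q - p) * D - (q - p) * B = y * (q - p)\<^sup>2"
            unfolding B_def D_def by algebra
          moreover have "0 \<le> y * (q - p)\<^sup>2" using assms by simp
          ultimately show ?thesis by linarith
        qed
        then have "(q - p) * B / D \<le> q - p" using pos by (simp add: pos_divide_le_eq)
        then show ?thesis using \<open>0 < lam\<close> by (rule mult_left_mono[OF _ less_imp_le])
      qed
      finally show ?thesis .
    next
      case False
      then have pz: "p = 0" using p0 by simp
      \<comment> \<open>At p = 0 the KKT inequality reduces to this, and A = 1; it remains to use D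
        >= 1.\<close>
      then have "x - y \<le> lam"
        using secrecy_policy_stationary(1)[of y x lam] True assms by (simp add: p_def)
      then have "(x - y) * q \<le> lam * q * 1" using assms by (simp add: mult_right_mono)
      also have "\<dots> \<le> lam * q * D" using assms by (intro mult_left_mono) (auto simp: D_def)
      finally show ?thesis using r1 pz pos by (simp add: A_def pos_divide_le_eq)
    qed
    ultimately show ?thesis by (simp add: algebra_simps)
  next
    case False
    \<comment> \<open>Both rates vanish, while q > 0 costs the positive amount lam q.\<close>
    then have "p = 0" by (simp add: p_def secrecy_policy_def)
    with False that assms show ?thesis by (simp add: wiretap_rate_def)
  qed
  then show "wiretap_rate x y q + lam * p \<le> wiretap_rate x y p + lam * q"
    by (cases "q = p") auto
  show "wiretap_rate x y p + lam * q \<le> wiretap_rate x y q + lam * p \<Longrightarrow> q = p"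
    using strict by force
qed

section \<open>Dependence of the policy on the multiplier\<close>

lemma tendsto_secrecy_policy:
  assumes "X \<longlonglongrightarrow> l" "0 < l"
  shows "(\<lambda>n. secrecy_policy (X n) x y) \<longlonglongrightarrow> secrecy_policy l x y"
  unfolding secrecy_policy_def using assms
  by (cases "y < x") (auto intro!: tendsto_intros)

text \<open>Dropping the square from the radicand leaves a lower bound growing like the square root
  of n. This is the pointwise divergence to which Fatou's lemma is applied.\<close>

lemma filterlim_secrecy_policy_at_top:
  assumes "0 < y" "y < x"
  shows "filterlim (\<lambda>n. secrecy_policy (1 / real (Suc n)) x y) at_top sequentially"
proof -
  define u where "u = 1 / y - 1 / x"
  have u: "0 < u" using assms by (simp add: u_def frac_less2)
  have "filterlim (\<lambda>n. sqrt (4 * u * real (Suc n))) at_top sequentially"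
    using u by real_asymp
  then have "filterlim (\<lambda>n. 1 / 2 * (- (1 / x + 1 / y) + sqrt (4 * u * real (Suc n)))) at_top sequentially"
    by (intro filterlim_tendsto_pos_mult_at_top[OF tendsto_const]
          filterlim_tendsto_add_at_top[OF tendsto_const]) auto
  then show ?thesis
  proof (rule filterlim_at_top_mono, intro always_eventually allI)
    fix n
    have "sqrt (4 * u * real (Suc n)) \<le> sqrt (u\<^sup>2 + 4 / (1 / real (Suc n)) * u)"
      by (intro real_sqrt_le_mono) (simp add: algebra_simps)
    then have "1 / 2 * (- (1 / x + 1 / y) + sqrt (4 * u * real (Suc n)))
        \<le> 1 / 2 * max 0 (sqrt (u\<^sup>2 + 4 / (1 / real (Suc n)) * u) - (1 / x + 1 / y))"
      by (intro mult_left_mono max.coboundedI2) (simp_all del: of_nat_Suc)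
    then show "1 / 2 * (- (1 / x + 1 / y) + sqrt (4 * u * real (Suc n)))
        \<le> secrecy_policy (1 / real (Suc n)) x y"
      unfolding secrecy_policy_def u_def[symmetric] if_P[OF assms(2)] .
  qed
qed

lemma borel_measurable_secrecy_policy [measurable]:
  "(\<lambda>(x, y). secrecy_policy lam x y) \<in> borel_measurable (borel \<Otimes>\<^sub>M borel)"
  unfolding secrecy_policy_def by measurable

section \<open>Random gains and the rate as an expectation\<close>

locale fading_channels = prob_space M
  for M :: "'a measure" +
  fixes hM hE :: "'a \<Rightarrow> real" and fM fE :: "real \<Rightarrow> real"
  assumes indep: "indep_var borel hM borel hE"
    and hM_nonneg: "\<omega> \<in> space M \<Longrightarrow> 0 \<le> hM \<omega>"
    and hE_nonneg: "\<omega> \<in> space M \<Longrightarrow> 0 \<le> hE \<omega>"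
    and distr_hM: "distributed M lborel hM (\<lambda>x. ennreal (fM x) * indicator {0..} x)"
    and distr_hE: "distributed M lborel hE (\<lambda>y. ennreal (fE y) * indicator {0..} y)"
    and fM_nonneg: "0 \<le> x \<Longrightarrow> 0 \<le> fM x"
    and fE_nonneg: "0 \<le> y \<Longrightarrow> 0 \<le> fE y"
begin

lemma measurable_gains [measurable]: "hM \<in> borel_measurable M" "hE \<in> borel_measurable M"
  using indep by (auto dest: indep_var_rv1 indep_var_rv2)

lemma distributed_gains:
  "distributed M (lborel \<Otimes>\<^sub>M lborel) (\<lambda>\<omega>. (hM \<omega>, hE \<omega>))
     (\<lambda>(x, y). ennreal (fM x) * indicator {0..} x * (ennreal (fE y) * indicator {0..} y))"
proof (rule distributed_joint_indep[OF _ _ distr_hM distr_hE])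
  show "indep_var lborel hM lborel hE"
    using indep by (simp add: indep_var_eq)
qed (unfold_locales)

text \<open>A distribution with a density does not charge {0}. The pointwise results, which require
  y > 0, therefore hold almost everywhere, and the convention 1/0 = 0 is harmless.\<close>

lemma AE_hE_pos: "AE \<omega> in M. 0 < hE \<omega>"
proof -
  have "emeasure M (hE -` {0} \<inter> space M) = 0"
    using distributed_emeasure[OF distr_hE, of "{0}"]
    by simp
  then have "AE \<omega> in M. hE \<omega> \<noteq> 0"
    by (intro AE_I[of _ _ "hE -` {0} \<inter> space M"]) auto
  then show ?thesis
    using AE_space by eventually_elim (metis hE_nonneg less_le)
qed

lemma measurable_policy_gains:
  assumes "(\<lambda>(x, y). Q x y) \<in> borel_measurable (restrict_space borel ({0..} \<times> {0..}))"
  shows "(\<lambda>\<omega>. Q (hM \<omega>) (hE \<omega>) :: real) \<in> borel_measurable M"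
proof -
  have "(\<lambda>\<omega>. (hM \<omega>, hE \<omega>)) \<in> measurable M (restrict_space borel ({0..} \<times> {0..}))"
    by (intro measurable_restrict_space2) (auto simp: hM_nonneg hE_nonneg simp flip: borel_prod)
  from measurable_compose[OF this assms] show ?thesis by simp
qed

text \<open>Tonelli's theorem turns the iterated integral into one over the plane, and the product
  density of the independent gains turns that into an expectation.\<close>

lemma secrecy_rate_eq:
  assumes meas: "(\<lambda>(x, y). Q x y) \<in> borel_measurable (restrict_space borel ({0..} \<times> {0..}))"
    and nonneg: "\<And>x y. 0 \<le> x \<Longrightarrow> 0 \<le> y \<Longrightarrow> 0 \<le> Q x y"
  shows "secrecy_rate fM fE Q = (\<integral>\<^sup>+\<omega>. ennreal (wiretap_rate (hM \<omega>) (hE \<omega>) (Q (hM \<omega>) (hE \<omega>))) \<partial>M)"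
proof -
  \<comment> \<open>\<open>Q\<close> is measurable only on the quadrant. Its extension by 0 is
    measurable on the plane, and the joint density vanishes wherever the two differ.\<close>
  define R where "R = (\<lambda>(x, y). if (x, y) \<in> {0..} \<times> {0..} then Q x y else 0)"
  have R_meas: "R \<in> borel_measurable (borel \<Otimes>\<^sub>M borel)"
  proof -
    have "(\<lambda>z. if z \<in> {0..} \<times> {0..} then (case z of (x, y) \<Rightarrow> Q x y) else 0) \<in> borel_measurable borel"
      using meas by (subst (asm) measurable_restrict_space_iff) (auto intro!: borel_closed closed_Times)
    also have "(\<lambda>z. if z \<in> {0..} \<times> {0..} then (case z of (x, y) \<Rightarrow> Q x y) else 0) = R"
      by (auto simp: R_def fun_eq_iff)
    finally show ?thesis by (simp add: borel_prod)
  qed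
  define w where "w = (\<lambda>(x, y). ennreal (wiretap_rate x y (R (x, y))))"
  define d where "d = (\<lambda>(x, y). ennreal (fM x) * indicator {0..} x * (ennreal (fE y) * indicator {0..} y))"
  have sets_eq: "sets (lborel \<Otimes>\<^sub>M lborel :: (real \<times> real) measure) = sets (borel \<Otimes>\<^sub>M borel)"
    by (intro sets_pair_measure_cong) auto
  have w_meas: "w \<in> borel_measurable (lborel \<Otimes>\<^sub>M lborel)"
    unfolding measurable_cong_sets[OF sets_eq refl] w_def wiretap_rate_def using R_meas
    by measurable
  have d_meas: "d \<in> borel_measurable (lborel \<Otimes>\<^sub>M lborel)"
    using distributed_borel_measurable[OF distributed_gains] by (simp add: d_def)
  have "secrecy_rate fM fE Q = (\<integral>\<^sup>+ y. (\<integral>\<^sup>+ x. d (x, y) * w (x, y) \<partial>lborel) \<partial>lborel)"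
    unfolding secrecy_rate_def
  proof (intro nn_integral_cong)
    fix y :: real
    show "(\<integral>\<^sup>+ x\<in>{y<..}. ennreal ((ln (1 + x * Q x y) - ln (1 + y * Q x y)) * fM x * fE y) \<partial>lborel)
        * indicator {0..} y = (\<integral>\<^sup>+ x. d (x, y) * w (x, y) \<partial>lborel)"
    proof (cases "0 \<le> y")
      case True
      have "ennreal ((ln (1 + x * Q x y) - ln (1 + y * Q x y)) * fM x * fE y) * indicator {y<..} x
          = d (x, y) * w (x, y)" for x
      proof (cases "y < x")
        case yx: True
        \<comment> \<open>Nonnegativity of each factor is what lets \<open>ennreal\<close>
          distribute over the product.\<close>
        have "0 \<le> ln (1 + x * Q x y) - ln (1 + y * Q x y)"
          using wiretap_rate_nonneg[of y "Q x y" x] nonneg[of x y] True yx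
          by (simp add: wiretap_rate_def)
        then show ?thesis
          using True yx fM_nonneg[of x] fE_nonneg[of y]
          by (simp add: d_def w_def R_def wiretap_rate_def ennreal_mult mult_ac)
      qed (simp add: w_def wiretap_rate_def)
      then show ?thesis using True by simp
    qed (simp add: d_def)
  qed
  also have "\<dots> = (\<integral>\<^sup>+ z. d z * w z \<partial>(lborel \<Otimes>\<^sub>M lborel))"
    using d_meas w_meas by (intro lborel_pair.nn_integral_snd[where f = "\<lambda>z. d z * w z"]) simp
  also have "\<dots> = (\<integral>\<^sup>+ \<omega>. w (hM \<omega>, hE \<omega>) \<partial>M)"
    unfolding d_def by (rule distributed_nn_integral[OF distributed_gains w_meas])
  also have "\<dots> = (\<integral>\<^sup>+\<omega>. ennreal (wiretap_rate (hM \<omega>) (hE \<omega>) (Q (hM \<omega>) (hE \<omega>))) \<partial>M)"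
    by (intro nn_integral_cong) (simp add: w_def R_def hM_nonneg hE_nonneg)
  finally show ?thesis .
qed

lemma measurable_secrecy_policy_quadrant:
  "(\<lambda>(x, y). secrecy_policy lam x y) \<in> borel_measurable (restrict_space borel ({0..} \<times> {0..}))"
  using borel_measurable_secrecy_policy by (intro measurable_restrict_space1) (simp add: borel_prod)

section \<open>Optimality and almost-everywhere uniqueness\<close>

text \<open>Only the finite term lam Pbar is cancelled, so optimality covers infinite rates.
  Uniqueness needs a finite value: from an infinite one, switching off the power where the rate is
  positive but below a large constant loses only a finite amount and leaves another
  maximizer.\<close>

lemma secrecy_policy_optimal:
  assumes lam: "0 < lam" and Pbar: "0 < Pbar"
    and power: "avg_power M hM hE (secrecy_policy lam) = ennreal Pbar"
    and Q: "feasible_policy M hM hE Pbar Q"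
  shows "secrecy_rate fM fE Q \<le> secrecy_rate fM fE (secrecy_policy lam)"
    and "secrecy_rate fM fE Q = secrecy_rate fM fE (secrecy_policy lam) \<Longrightarrow>
         secrecy_rate fM fE (secrecy_policy lam) < \<infinity> \<Longrightarrow>
         AE \<omega> in M. Q (hM \<omega>) (hE \<omega>) = secrecy_policy lam (hM \<omega>) (hE \<omega>)"
proof -
  define q where "q \<omega> = Q (hM \<omega>) (hE \<omega>)" for \<omega>
  define p where "p \<omega> = secrecy_policy lam (hM \<omega>) (hE \<omega>)" for \<omega>
  define g where "g r \<omega> = wiretap_rate (hM \<omega>) (hE \<omega>) (r \<omega>)" for r \<omega>
  have Q_meas: "(\<lambda>(x, y). Q x y) \<in> borel_measurable (restrict_space borel ({0..} \<times> {0..}))"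
    and Q_nonneg: "\<And>x y. 0 \<le> x \<Longrightarrow> 0 \<le> y \<Longrightarrow> 0 \<le> Q x y"
    and Q_power: "avg_power M hM hE Q \<le> ennreal Pbar"
    using Q by (auto simp: feasible_policy_def)
  have [measurable]: "q \<in> borel_measurable M" "p \<in> borel_measurable M"
    using measurable_policy_gains[OF Q_meas] measurable_policy_gains[OF measurable_secrecy_policy_quadrant]
    unfolding q_def[abs_def] p_def[abs_def] by auto
  have [measurable]: "g r \<in> borel_measurable M" if [measurable]: "r \<in> borel_measurable M" for r
    unfolding g_def wiretap_rate_def by measurable
  have p0: "0 \<le> p \<omega>" for \<omega> by (simp add: p_def secrecy_policy_nonneg)
  have q0: "0 \<le> q \<omega>" if "\<omega> \<in> space M" for \<omega> using that by (simp add: q_def Q_nonneg hM_nonneg hE_nonneg)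
  have g0: "0 \<le> g r \<omega>" if "\<omega> \<in> space M" "0 \<le> r \<omega>" for r \<omega>
    using that by (simp add: g_def wiretap_rate_nonneg hE_nonneg)
  have rate_q: "secrecy_rate fM fE Q = (\<integral>\<^sup>+\<omega>. ennreal (g q \<omega>) \<partial>M)"
    using secrecy_rate_eq[OF Q_meas Q_nonneg] by (simp add: g_def q_def)
  have rate_p: "secrecy_rate fM fE (secrecy_policy lam) = (\<integral>\<^sup>+\<omega>. ennreal (g p \<omega>) \<partial>M)"
    using secrecy_rate_eq[OF measurable_secrecy_policy_quadrant secrecy_policy_nonneg]
    by (simp add: g_def p_def)
  have int_q: "(\<integral>\<^sup>+\<omega>. ennreal (q \<omega>) \<partial>M) \<le> ennreal Pbar"
    using Q_power by (simp add: avg_power_def q_def)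
  have int_p: "(\<integral>\<^sup>+\<omega>. ennreal (p \<omega>) \<partial>M) = ennreal Pbar"
    using power by (simp add: avg_power_def p_def)
  \<comment> \<open>Rate and power come from different policies: the Lagrangian inequality is kept
    in crosswise form, so that all terms are nonnegative and no subtraction in
    \<open>ennreal\<close> occurs.\<close>
  have split: "(\<integral>\<^sup>+\<omega>. ennreal (g r \<omega> + lam * s \<omega>) \<partial>M)
      = (\<integral>\<^sup>+\<omega>. ennreal (g r \<omega>) \<partial>M) + ennreal lam * (\<integral>\<^sup>+\<omega>. ennreal (s \<omega>) \<partial>M)"
    if [measurable]: "r \<in> borel_measurable M" "s \<in> borel_measurable M"
      and "\<And>\<omega>. \<omega> \<in> space M \<Longrightarrow> 0 \<le> r \<omega>" "\<And>\<omega>. \<omega> \<in> space M \<Longrightarrow> 0 \<le> s \<omega>" for r s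
  proof -
    have "(\<integral>\<^sup>+\<omega>. ennreal (g r \<omega> + lam * s \<omega>) \<partial>M) = (\<integral>\<^sup>+\<omega>. ennreal (g r \<omega>) + ennreal lam * ennreal (s \<omega>) \<partial>M)"
      using lam that by (intro nn_integral_cong) (simp add: ennreal_plus g0 ennreal_mult)
    then show ?thesis by (simp add: nn_integral_add nn_integral_cmult)
  qed
  have lagrangian: "AE \<omega> in M. g q \<omega> + lam * p \<omega> \<le> g p \<omega> + lam * q \<omega>"
    using AE_hE_pos AE_space
  proof eventually_elim
    case (elim \<omega>)
    then show ?case
      using secrecy_policy_lagrangian(1)[of "hE \<omega>" lam "q \<omega>" "hM \<omega>"] lam q0
      by (simp add: g_def p_def)
  qed
  then have "(\<integral>\<^sup>+\<omega>. ennreal (g q \<omega> + lam * p \<omega>) \<partial>M) \<le> (\<integral>\<^sup>+\<omega>. ennreal (g p \<omega> + lam * q \<omega>) \<partial>M)"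
    by (intro nn_integral_mono_AE) (auto elim!: eventually_mono intro: ennreal_leI)
  also have up: "\<dots> \<le> secrecy_rate fM fE (secrecy_policy lam) + ennreal lam * ennreal Pbar"
    by (subst split) (auto simp: p0 q0 rate_p int_q intro!: add_left_mono mult_left_mono)
  finally have "secrecy_rate fM fE Q + ennreal lam * ennreal Pbar
      \<le> secrecy_rate fM fE (secrecy_policy lam) + ennreal lam * ennreal Pbar"
    by (subst (asm) split) (auto simp: p0 q0 rate_q int_p)
  then show "secrecy_rate fM fE Q \<le> secrecy_rate fM fE (secrecy_policy lam)"
    unfolding add.commute[of _ "ennreal lam * ennreal Pbar"]
    by (simp add: ennreal_add_left_cancel_le ennreal_mult_eq_top_iff)
  assume eq: "secrecy_rate fM fE Q = secrecy_rate fM fE (secrecy_policy lam)"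
    and fin: "secrecy_rate fM fE (secrecy_policy lam) < \<infinity>"
  \<comment> \<open>With equal rates, the smaller Lagrangian integral already attains the upper
    bound \<open>up\<close> of the larger one.\<close>
  have low: "(\<integral>\<^sup>+\<omega>. ennreal (g q \<omega> + lam * p \<omega>) \<partial>M)
      = secrecy_rate fM fE (secrecy_policy lam) + ennreal lam * ennreal Pbar"
    by (subst split) (auto simp: p0 q0 rate_q int_p simp flip: eq)
  have "AE \<omega> in M. ennreal (g p \<omega> + lam * q \<omega>) \<le> ennreal (g q \<omega> + lam * p \<omega>)"
  proof (rule ccontr)
    assume "\<not> ?thesis"
    \<comment> \<open>If the reverse inequality failed on a set of positive measure, the two ordered
      integrands would have strictly ordered integrals, the smaller one being finite;
      \<open>up\<close> and \<open>low\<close> exclude this.\<close>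
    then have "(\<integral>\<^sup>+\<omega>. ennreal (g q \<omega> + lam * p \<omega>) \<partial>M) < (\<integral>\<^sup>+\<omega>. ennreal (g p \<omega> + lam * q \<omega>) \<partial>M)"
      using lagrangian fin low
      by (intro nn_integral_less) (auto elim!: eventually_mono intro: ennreal_leI simp: ennreal_mult_eq_top_iff)
    with up low show False by simp
  qed
  then show "AE \<omega> in M. Q (hM \<omega>) (hE \<omega>) = secrecy_policy lam (hM \<omega>) (hE \<omega>)"
    using AE_hE_pos AE_space
  proof eventually_elim
    case (elim \<omega>)
    then have "g p \<omega> + lam * q \<omega> \<le> g q \<omega> + lam * p \<omega>"
      using lam ennreal_le_iff[of "g q \<omega> + lam * p \<omega>" "g p \<omega> + lam * q \<omega>"]
      by (simp add: g0 q0 p0 del: ennreal_plus)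
    then show ?case
      using secrecy_policy_lagrangian(2)[of "hE \<omega>" lam "q \<omega>" "hM \<omega>"] elim lam q0
      by (simp add: g_def p_def q_def)
  qed
qed

section \<open>Existence of the multiplier\<close>

lemma avg_power_secrecy_policy_eq:
  assumes "0 < lam"
  shows "avg_power M hM hE (secrecy_policy lam)
    = ennreal (\<integral>\<omega>. secrecy_policy lam (hM \<omega>) (hE \<omega>) \<partial>M)"
  unfolding avg_power_def
proof (intro nn_integral_eq_integral integrable_const_bound[where B = "1 / lam"])
  show "AE \<omega> in M. norm (secrecy_policy lam (hM \<omega>) (hE \<omega>)) \<le> 1 / lam"
    using AE_space by eventually_elim (simp add: secrecy_policy_nonneg secrecy_policy_le hE_nonneg assms)
qed (auto simp: secrecy_policy_nonneg intro!: measurable_policy_gains measurable_secrecy_policy_quadrant)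

text \<open>If the main channel were almost surely no better, the policy would vanish almost surely
  for every multiplier and could not use a positive budget.\<close>

lemma ex_multiplier:
  assumes pos: "0 < measure M {\<omega> \<in> space M. hE \<omega> < hM \<omega>}" and Pbar: "0 < Pbar"
  shows "\<exists>lam>0. avg_power M hM hE (secrecy_policy lam) = ennreal Pbar"
proof -
  define A where "A lam = (\<integral>\<omega>. secrecy_policy lam (hM \<omega>) (hE \<omega>) \<partial>M)" for lam
  have meas [measurable]: "(\<lambda>\<omega>. secrecy_policy lam (hM \<omega>) (hE \<omega>)) \<in> borel_measurable M" for lam
    by (intro measurable_policy_gains measurable_secrecy_policy_quadrant)
  \<comment> \<open>Dominated convergence: on an interval bounded away from 0, the constant 1/a
    dominates all policies.\<close>
  have cont: "continuous_on {a..b} A" if "0 < a" for a b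
  proof (rule continuous_on_sequentiallyI)
    fix X :: "nat \<Rightarrow> real" and l
    assume X: "\<forall>n. X n \<in> {a..b}" and l: "l \<in> {a..b}" and lim: "X \<longlonglongrightarrow> l"
    show "(\<lambda>n. A (X n)) \<longlonglongrightarrow> A l"
      unfolding A_def
    proof (rule integral_dominated_convergence[where w = "\<lambda>_. 1 / a"])
      show "AE \<omega> in M. (\<lambda>n. secrecy_policy (X n) (hM \<omega>) (hE \<omega>)) \<longlonglongrightarrow> secrecy_policy l (hM \<omega>) (hE \<omega>)"
        using lim l that by (intro AE_I2 tendsto_secrecy_policy) auto
      fix n
      have "a \<le> X n" using X by simp
      then have "1 / X n \<le> 1 / a" "0 < X n" using that by (auto intro: frac_le)
      then show "AE \<omega> in M. norm (secrecy_policy (X n) (hM \<omega>) (hE \<omega>)) \<le> 1 / a"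
        by (intro AE_I2) (simp add: secrecy_policy_nonneg order_trans[OF secrecy_policy_le] hE_nonneg)
    qed auto
  qed
  \<comment> \<open>At lam = 1 / Pbar the uniform bound 1 / lam equals the budget.\<close>
  have upper: "A (1 / Pbar) \<le> Pbar"
  proof -
    have "A (1 / Pbar) \<le> (\<integral>\<omega>. Pbar \<partial>M)"
      unfolding A_def
    proof (rule integral_mono_AE)
      have "AE \<omega> in M. norm (secrecy_policy (1 / Pbar) (hM \<omega>) (hE \<omega>)) \<le> Pbar"
        using AE_space
      proof eventually_elim
        case (elim \<omega>)
        then show ?case
          using secrecy_policy_le[of "hE \<omega>" "1 / Pbar" "hM \<omega>"] Pbar
          by (simp add: secrecy_policy_nonneg hE_nonneg)
      qed
      then show "integrable M (\<lambda>\<omega>. secrecy_policy (1 / Pbar) (hM \<omega>) (hE \<omega>))"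
        and "AE \<omega> in M. secrecy_policy (1 / Pbar) (hM \<omega>) (hE \<omega>) \<le> Pbar"
        by (auto intro!: integrable_const_bound elim!: eventually_mono)
    qed auto
    then show ?thesis by (simp add: prob_space)
  qed
  have "\<exists>n. Pbar < A (1 / real (Suc n))"
  proof (rule ccontr)
    assume "\<not> ?thesis"
    then have "A (1 / real (Suc n)) \<le> Pbar" for n
      by (meson not_less)
    then have le: "avg_power M hM hE (secrecy_policy (1 / real (Suc n))) \<le> ennreal Pbar" for n
      by (subst avg_power_secrecy_policy_eq) (simp, rule ennreal_leI, simp only: A_def)
    \<comment> \<open>Fatou's lemma: the limit inferior is infinite on an event of positive
      probability, yet its integral would be at most \<open>Pbar\<close>.\<close>
    have "emeasure M {\<omega> \<in> space M. hE \<omega> < hM \<omega>} * \<infinity>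
        = (\<integral>\<^sup>+\<omega>. \<infinity> * indicator {\<omega> \<in> space M. hE \<omega> < hM \<omega>} \<omega> \<partial>M)"
      by (subst nn_integral_cmult_indicator) (auto simp: mult.commute)
    also have "\<dots> \<le> (\<integral>\<^sup>+\<omega>. liminf (\<lambda>n. ennreal (secrecy_policy (1 / real (Suc n)) (hM \<omega>) (hE \<omega>))) \<partial>M)"
    proof (rule nn_integral_mono_AE)
      show "AE \<omega> in M. \<infinity> * indicator {\<omega> \<in> space M. hE \<omega> < hM \<omega>} \<omega>
          \<le> liminf (\<lambda>n. ennreal (secrecy_policy (1 / real (Suc n)) (hM \<omega>) (hE \<omega>)))"
        using AE_hE_pos
      proof eventually_elim
        case (elim \<omega>)
        show ?case
        proof (cases "hE \<omega> < hM \<omega>")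
          case True
          then have "(\<lambda>n. ennreal (secrecy_policy (1 / real (Suc n)) (hM \<omega>) (hE \<omega>))) \<longlonglongrightarrow> top"
            unfolding ennreal_tendsto_top_eq_at_top
            using filterlim_secrecy_policy_at_top elim by blast
          then show ?thesis by (simp add: lim_imp_Liminf)
        qed simp
      qed
    qed
    also have "\<dots> \<le> liminf (\<lambda>n. avg_power M hM hE (secrecy_policy (1 / real (Suc n))))"
      unfolding avg_power_def by (rule nn_integral_liminf) measurable
    also have "\<dots> \<le> ennreal Pbar"
      using le by (intro Liminf_le) auto
    finally show False
      using pos by (simp add: emeasure_eq_measure ennreal_mult_top top_unique split: if_splits)
  qed
  then obtain n where n: "Pbar < A (1 / real (Suc n))" by blast
  define c where "c = 1 / real (Suc n)"
  have c: "0 < c" "0 < 1 / Pbar" "Pbar \<le> A c" using n Pbar by (simp_all add: c_def)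
  have "\<exists>lam. 0 < lam \<and> A lam = Pbar"
  \<comment> \<open>The intermediate value theorem needs ordered endpoints; each order of
    \<open>c\<close> and 1 / Pbar is handled by its own version instead of comparing them.\<close>
  proof (cases "c \<le> 1 / Pbar")
    case True
    then obtain lam where "c \<le> lam" "A lam = Pbar"
      using IVT2'[of A "1 / Pbar" Pbar c] upper c(3) cont[OF c(1)] by blast
    with c(1) show ?thesis by (intro exI[of _ lam]) linarith
  next
    case False
    then have "1 / Pbar \<le> c" by linarith
    then obtain lam where "1 / Pbar \<le> lam" "A lam = Pbar"
      using IVT'[of A "1 / Pbar" Pbar c] upper c(3) cont[OF c(2)] by blast
    with c(2) show ?thesis by (intro exI[of _ lam]) linarith
  qed
  then show ?thesis
    using avg_power_secrecy_policy_eq by (auto simp: A_def)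
qed

end

theorem mainTheorem4:
  fixes M :: "'a measure" and hM hE :: "'a \<Rightarrow> real" and fM fE :: "real \<Rightarrow> real" and Pbar :: real
  assumes "prob_space M"
    and "prob_space.indep_var M borel hM borel hE"
    and "\<And>\<omega>. \<omega> \<in> space M \<Longrightarrow> 0 \<le> hM \<omega>"
    and "\<And>\<omega>. \<omega> \<in> space M \<Longrightarrow> 0 \<le> hE \<omega>"
    and "distributed M lborel hM (\<lambda>x. ennreal (fM x) * indicator {0..} x)"
    and "distributed M lborel hE (\<lambda>y. ennreal (fE y) * indicator {0..} y)"
    and "\<And>x. 0 \<le> x \<Longrightarrow> 0 \<le> fM x" and "continuous_on {0..} fM" and "bounded (fM ` {0..})"
    and "\<And>y. 0 \<le> y \<Longrightarrow> 0 \<le> fE y" and "continuous_on {0..} fE" and "bounded (fE ` {0..})"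
    and "0 < Pbar"
  shows "(measure M {\<omega> \<in> space M. hE \<omega> < hM \<omega>} > 0 \<longrightarrow>
            (\<exists>lam>0. avg_power M hM hE (secrecy_policy lam) = ennreal Pbar)) \<and>
         (\<forall>lam>0. avg_power M hM hE (secrecy_policy lam) = ennreal Pbar \<longrightarrow>
            is_arg_max (secrecy_rate fM fE) (feasible_policy M hM hE Pbar) (secrecy_policy lam) \<and>
            (secrecy_rate fM fE (secrecy_policy lam) < \<infinity> \<longrightarrow>
               (\<forall>Q. is_arg_max (secrecy_rate fM fE) (feasible_policy M hM hE Pbar) Q \<longrightarrow>
                  (AE \<omega> in M. Q (hM \<omega>) (hE \<omega>) = secrecy_policy lam (hM \<omega>) (hE \<omega>)))))"
proof -
  interpret prob_space M by fact
  interpret fading_channels M hM hE fM fE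
    using assms by unfold_locales auto
  have feasible: "feasible_policy M hM hE Pbar (secrecy_policy lam)"
    if "avg_power M hM hE (secrecy_policy lam) = ennreal Pbar" for lam
    using that by (simp add: feasible_policy_def secrecy_policy_nonneg measurable_secrecy_policy_quadrant)
  have opt: "is_arg_max (secrecy_rate fM fE) (feasible_policy M hM hE Pbar) (secrecy_policy lam)"
    if "0 < lam" "avg_power M hM hE (secrecy_policy lam) = ennreal Pbar" for lam
    unfolding is_arg_max_def
    using feasible secrecy_policy_optimal(1)[OF _ \<open>0 < Pbar\<close>] that by (auto simp: not_less)
  have unique: "AE \<omega> in M. Q (hM \<omega>) (hE \<omega>) = secrecy_policy lam (hM \<omega>) (hE \<omega>)"
    if "0 < lam" "avg_power M hM hE (secrecy_policy lam) = ennreal Pbar"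
      "secrecy_rate fM fE (secrecy_policy lam) < \<infinity>"
      "is_arg_max (secrecy_rate fM fE) (feasible_policy M hM hE Pbar) Q" for lam Q
  proof (rule secrecy_policy_optimal(2)[OF that(1) \<open>0 < Pbar\<close> that(2)])
    show Q: "feasible_policy M hM hE Pbar Q"
      using that by (simp add: is_arg_max_def)
    have "\<not> secrecy_rate fM fE Q < secrecy_rate fM fE (secrecy_policy lam)"
      using that feasible by (auto simp: is_arg_max_def)
    then show "secrecy_rate fM fE Q = secrecy_rate fM fE (secrecy_policy lam)"
      using secrecy_policy_optimal(1)[OF that(1) \<open>0 < Pbar\<close> that(2) Q] by simp
  qed (fact that)
  show ?thesis
    using ex_multiplier[OF _ \<open>0 < Pbar\<close>] opt unique by blast
qed

end
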